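(* There exists a subshift $X$ over a finite alphabet such that $X$ has left almost specification with mistake function $g(n)=1+2\lfloor\log_2\log_2 n\rfloor$ (for $n\ge 2$, with $g(1)=1$), and $X$ has multiple measures of maximal entropy with disjoint supports (i.e. at least two measures of maximal entropy whose supports are disjoint).
   Context: Let $A$ be a finite alphabet. $A^{\mathbb Z}$ carries the product topology and the shift $(\sigma x)(m)=x(m+1)$. A subshift is a closed subset $X\subset A^{\mathbb Z}$ with $\sigma(X)=X$. Its language $\mathcal L(X)$ is the set of all finite words appearing in points of $X$; $\mathcal L_n(X)$ is the set of those of length $n$; $|w|$ is the length of the word $w$. For words of equal length, $d_H(v,w)=|\{i: v(i)\neq w(i)\}|$ (Hamming distance). Left almost specification (LAS) with mistake function $g$: $g(n)/n\to 0$, and for any $w^{(1)},w^{(2)}\in\mathcal L(X)$ there is $\bar w^{(1)}\in\mathcal L(X)$ of length $|w^{(1)}|$ with $d_H(\bar w^{(1)},w^{(1)})\le g(|w^{(1)}|)$ and $\bar w^{(1)}w^{(2)}\in\mathcal L(X)$ (the distance condition is vacuous for the empty word). Topological entropy: $h(X)=\lim_n\frac1n\ln|\mathcal L_n(X)|$. For $w\in A^n$, $[w]$ is the set of $x$ with $x(1)\cdots x(n)=w$. For a $\sigma$-invariant Borel probability measure $\mu$ on $X$, $h(\mu)=\lim_n -\frac1n\sum_{w\in A^n}\mu([w])\ln\mu([w])$ (zero terms omitted). A measure of maximal entropy is such a $\mu$ with $h(\mu)=h(X)$. *)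

theory Defs
  imports "HOL-Probability.Probability"
begin

text \<open>
  Bi-infinite sequences over an alphabet \<open>A\<close> are functions \<open>int \<Rightarrow> 'a\<close> with values in \<open>A\<close>, where
  \<open>'a\<close> is a type with the discrete topology; \<open>closed\<close>, \<open>open\<close> and \<open>borel\<close> on \<open>int \<Rightarrow> 'a\<close>
  then refer to the product topology.  The full shift over \<open>A\<close> is closed in that space, so its
  closed subsets are exactly its subsets that are closed in \<open>int \<Rightarrow> 'a\<close>.
\<close>

definition full_shift :: "'a set \<Rightarrow> (int \<Rightarrow> 'a) set" where
  "full_shift A = {x. \<forall>m. x m \<in> A}"

definition shift :: "(int \<Rightarrow> 'a) \<Rightarrow> int \<Rightarrow> 'a" where
  "shift x = (\<lambda>m. x (m + 1))"

definition subshift :: "'a::discrete_topology set \<Rightarrow> (int \<Rightarrow> 'a) set \<Rightarrow> bool" where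
  "subshift A X \<longleftrightarrow> X \<subseteq> full_shift A \<and> closed X \<and> shift ` X = X"

definition word_at :: "(int \<Rightarrow> 'a) \<Rightarrow> int \<Rightarrow> nat \<Rightarrow> 'a list" where
  "word_at x m n = map (\<lambda>i. x (m + int i)) [0..<n]"

definition language :: "(int \<Rightarrow> 'a) set \<Rightarrow> 'a list set" where
  "language X = {w. \<exists>x\<in>X. \<exists>m. w = word_at x m (length w)}"

definition language_n :: "(int \<Rightarrow> 'a) set \<Rightarrow> nat \<Rightarrow> 'a list set" where
  "language_n X n = {w \<in> language X. length w = n}"

text \<open>Only meaningful for words of equal length.\<close>

definition hamming :: "'a list \<Rightarrow> 'a list \<Rightarrow> nat" where
  "hamming v w = card {i. i < length v \<and> v ! i \<noteq> w ! i}"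

text \<open>The value \<open>g 0\<close> is irrelevant: no distance condition is imposed on the empty word.\<close>

definition left_almost_specification :: "(int \<Rightarrow> 'a) set \<Rightarrow> (nat \<Rightarrow> nat) \<Rightarrow> bool" where
  "left_almost_specification X g \<longleftrightarrow>
     (\<lambda>n. real (g n) / real n) \<longlonglongrightarrow> 0 \<and>
     (\<forall>w1\<in>language X. \<forall>w2\<in>language X.
        \<exists>v\<in>language X. length v = length w1 \<and>
          (w1 \<noteq> [] \<longrightarrow> hamming v w1 \<le> g (length w1)) \<and>
          v @ w2 \<in> language X)"

definition topological_entropy :: "(int \<Rightarrow> 'a) set \<Rightarrow> real" where
  "topological_entropy X = lim (\<lambda>n. ln (real (card (language_n X n))) / real n)"

definition cylinder :: "'a list \<Rightarrow> (int \<Rightarrow> 'a) set" where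
  "cylinder w = {x. word_at x 1 (length w) = w}"

definition invariant_prob ::
    "(int \<Rightarrow> 'a::discrete_topology) set \<Rightarrow> (int \<Rightarrow> 'a) measure \<Rightarrow> bool" where
  "invariant_prob X \<mu> \<longleftrightarrow>
     prob_space \<mu> \<and> space \<mu> = X \<and> sets \<mu> = sets (restrict_space borel X) \<and>
     (\<forall>B\<in>sets \<mu>. measure \<mu> (shift -` B \<inter> X) = measure \<mu> B)"

text \<open>Terms with \<open>\<mu>([w]) = 0\<close> vanish, as they carry the factor 0.\<close>

definition measure_entropy :: "'a set \<Rightarrow> (int \<Rightarrow> 'a) measure \<Rightarrow> real" where
  "measure_entropy A \<mu> =
     lim (\<lambda>n. - (\<Sum>w | set w \<subseteq> A \<and> length w = n.
                  measure \<mu> (cylinder w \<inter> space \<mu>) * ln (measure \<mu> (cylinder w \<inter> space \<mu>))) / real n)"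

definition max_entropy_measure ::
    "'a::discrete_topology set \<Rightarrow> (int \<Rightarrow> 'a) set \<Rightarrow> (int \<Rightarrow> 'a) measure \<Rightarrow> bool" where
  "max_entropy_measure A X \<mu> \<longleftrightarrow>
     invariant_prob X \<mu> \<and> measure_entropy A \<mu> = topological_entropy X"

definition measure_support :: "(int \<Rightarrow> 'a::discrete_topology) measure \<Rightarrow> (int \<Rightarrow> 'a) set" where
  "measure_support \<mu> =
     {x \<in> space \<mu>. \<forall>U. open U \<and> x \<in> U \<longrightarrow> measure \<mu> (U \<inter> space \<mu>) > 0}"

text \<open>The double logarithm is nonnegative for \<open>n \<ge> 2\<close>, so \<open>nat\<close> does not truncate.\<close>

definition mistake_loglog :: "nat \<Rightarrow> nat" where
  "mistake_loglog n = (if n \<ge> 2 then 1 + 2 * nat \<lfloor>log 2 (log 2 (real n))\<rfloor> else 1)"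

end

theory Submission
  imports Defs "HOL-Real_Asymp.Real_Asymp"
begin

text \<open>
  The alphabet consists of a marker \<open>0\<close> and two disjoint colours of 512 letters each.  A point of
  the subshift is a sequence in which maximal marker-free runs are monochrome, and in which every
  run that is followed by a marker lies in a prescribed set of \<^emph>\<open>closable\<close> words.  Runs that never
  end on the right are unrestricted, so the subshift contains the full shift over each colour.  Each
  of these carries its uniform Bernoulli measure, of entropy \<open>ln 512\<close>.  Everything therefore rests
  on choosing the closable words so that

  \<^item> suffixes of closable words are closable, so that any legal word may stand after a marker
    (\<open>closable_suffix\<close>, \<open>legal_join\<close>);

  \<^item> every monochrome word of length \<open>n \<ge> 2\<close> becomes closable after at most
    \<open>2 \<lfloor>log\<^sub>2 log\<^sub>2 n\<rfloor>\<close> changes (\<open>correction\<close>, \<open>card_checks\<close>);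

  \<^item> the proportion of closable words among the words of length \<open>n\<close> has a finite sum over \<open>n\<close>
    (\<open>card_closable_words\<close>, \<open>sum_check_density_le\<close>).

  The first two properties give left almost specification: replace the last letter of the left word
  by a marker and correct the rest of its last run.  The third makes markers too expensive to
  raise the entropy: cutting a legal word at its first marker yields a renewal inequality, from
  which the number of legal words of length \<open>n\<close> is at most \<open>4 * 512 ^ n\<close> (\<open>card_legal\<close>).
  So the topological entropy is \<open>ln 512\<close>, and both Bernoulli measures attain it.

  The third property requires a proportion somewhat below \<open>1 / n\<close>, which is obtained by imposing
  Hamming codes scale by scale.  Number the positions of a run from its right end.  For every
  \<open>i \<ge> 1\<close> with \<open>2 ^ 2 ^ i \<le> n\<close> the two windows \<open>[2 ^ k, 2 ^ (k + 1))\<close>, \<open>k = 2 ^ i - 1\<close> and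
  \<open>k = 2 ^ i - 2\<close>, must be Hamming code words.  Each window is repaired by one change and has
  proportion \<open>1 / 2 ^ k\<close>, so there are two changes per scale and \<open>\<lfloor>log\<^sub>2 log\<^sub>2 n\<rfloor>\<close> scales.  The
  windows of the scales up to \<open>i\<close> together have proportion \<open>2 ^ (3 * i + 4) / N\<^sup>2\<close>, where
  \<open>N = 2 ^ 2 ^ (i + 1)\<close> bounds the lengths \<open>n\<close> to which just these scales apply; these lengths
  contribute at most \<open>2 ^ (3 * i + 4) / N\<close>, which is summable over \<open>i\<close>.
\<close>

section \<open>Hamming codes on dyadic windows\<close>

primrec xor_sum :: "(nat \<Rightarrow> nat) \<Rightarrow> nat \<Rightarrow> nat" where
  "xor_sum f 0 = 0"
| "xor_sum f (Suc n) = xor (xor_sum f n) (f n)"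

lemma xor_sum_less:
  assumes "\<And>r. r < n \<Longrightarrow> f r < 2 ^ k"
  shows "xor_sum f n < 2 ^ k"
  using assms
proof (induction n)
  case (Suc n)
  then have "xor_sum f n < 2 ^ k" "f n < 2 ^ k" by auto
  then show ?case
    by (simp add: take_bit_nat_eq_self_iff[symmetric] take_bit_xor)
qed simp

lemma xor_sum_cong:
  "(\<And>r. r < n \<Longrightarrow> f r = g r) \<Longrightarrow> xor_sum f n = xor_sum g n"
  by (induction n) auto

lemma xor_sum_change:
  assumes "s < n" "\<And>r. r < n \<Longrightarrow> r \<noteq> s \<Longrightarrow> g r = f r" "g s = xor (f s) d"
  shows "xor_sum g n = xor (xor_sum f n) d"
  using assms
proof (induction n)
  case (Suc n)
  show ?case
  proof (cases "s = n")
    case True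
    with Suc.prems have "xor_sum g n = xor_sum f n" by (intro xor_sum_cong) auto
    with True Suc.prems show ?thesis by (simp add: xor.assoc)
  next
    case False
    with Suc have "xor_sum g n = xor (xor_sum f n) d" by auto
    with False Suc.prems show ?thesis by (simp add: xor.assoc xor.commute xor.left_commute)
  qed
qed simp

text \<open>
  The binary Hamming syndrome of the parities in the window \<open>[2 ^ k, 2 ^ (k + 1))\<close>: a letter counts
  as the bit \<open>odd\<close>, and the offset \<open>r\<close> in the window is the parity check column.  The
  column \<open>0\<close> makes a change at offset \<open>0\<close> harmless, so a word can be corrected by exactly one
  change whether or not it is a code word already.
\<close>

definition syndrome :: "nat \<Rightarrow> (nat \<Rightarrow> nat) \<Rightarrow> nat" where
  "syndrome k y = xor_sum (\<lambda>r. if odd (y (2 ^ k + r)) then r else 0) (2 ^ k)"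

lemma syndrome_less: "syndrome k y < 2 ^ k"
  unfolding syndrome_def by (rule xor_sum_less) auto

lemma syndrome_cong:
  "(\<And>p. 2 ^ k \<le> p \<Longrightarrow> p < 2 ^ Suc k \<Longrightarrow> y p = z p) \<Longrightarrow> syndrome k y = syndrome k z"
  unfolding syndrome_def by (intro xor_sum_cong) auto

text \<open>
  Toggles the parity of a letter without leaving its pair \<open>{2 * a, 2 * a + 1}\<close>, hence without leaving
  its colour.
\<close>

definition flip :: "nat \<Rightarrow> nat" where
  "flip c = (if even c then c + 1 else c - 1)"

lemma odd_flip [simp]: "odd (flip c) \<longleftrightarrow> even c"
  unfolding flip_def by auto

lemma flip_flip [simp]: "flip (flip c) = c"
  unfolding flip_def by auto

definition flip_on :: "nat set \<Rightarrow> (nat \<Rightarrow> nat) \<Rightarrow> nat \<Rightarrow> nat" where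
  "flip_on P y p = (if p \<in> P then flip (y p) else y p)"

lemma window_disjoint:
  fixes s s' k l :: nat
  assumes "2 ^ k + s = 2 ^ l + s'" "s < 2 ^ k" "s' < 2 ^ l"
  shows "k = l"
proof -
  have "\<not> k < l" if "2 ^ k + s = 2 ^ l + s'" "s < 2 ^ k" for k l s s' :: nat
  proof
    assume "k < l"
    then have "(2::nat) ^ Suc k \<le> 2 ^ l" by (intro power_increasing) auto
    with that show False by auto
  qed
  from this[of k s l s'] this[of l s' k s] assms show ?thesis by auto
qed

text \<open>
  One flip per window, at offset \<open>s k\<close>, shifts the syndrome of that window by \<open>s k\<close>, since windows
  for distinct \<open>k\<close> are disjoint.  With \<open>s\<close> the syndromes themselves this corrects all windows at
  once; with \<open>s\<close> arbitrary it parametrises the cosets of the code and so computes its density.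
\<close>

lemma syndrome_flip_on:
  assumes "k \<in> K" "\<And>l. l \<in> K \<Longrightarrow> s l < 2 ^ l"
  shows "syndrome k (flip_on ((\<lambda>l. 2 ^ l + s l) ` K) y) = xor (syndrome k y) (s k)"
  unfolding syndrome_def
proof (rule xor_sum_change[where s = "s k"])
  show "s k < 2 ^ k" using assms by auto
  let ?P = "(\<lambda>l. 2 ^ l + s l) ` K"
  fix r :: nat
  assume r: "r < 2 ^ k" "r \<noteq> s k"
  have "2 ^ k + r \<notin> ?P"
  proof
    assume "2 ^ k + r \<in> ?P"
    then obtain l where l: "l \<in> K" "2 ^ k + r = 2 ^ l + s l" by auto
    with window_disjoint[OF l(2) r(1)] assms(2) have "k = l" by auto
    with l r show False by auto
  qed
  then show "(if odd (flip_on ?P y (2 ^ k + r)) then r else 0) =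
      (if odd (y (2 ^ k + r)) then r else 0)"
    by (simp add: flip_on_def)
next
  show "(if odd (flip_on ((\<lambda>l. 2 ^ l + s l) ` K) y (2 ^ k + s k)) then s k else 0) =
    xor (if odd (y (2 ^ k + s k)) then s k else 0) (s k)"
    using assms(1) by (simp add: flip_on_def)
qed

text \<open>
  The windows imposed on a run of length \<open>n\<close>.  Both windows of scale \<open>i\<close> are imposed only from
  length \<open>2 ^ 2 ^ i\<close> on, although the second already fits into half of that, because only then does the
  mistake function grant two further changes.
\<close>

definition checks :: "nat \<Rightarrow> nat set" where
  "checks n = {k. \<exists>i\<ge>1. 2 ^ 2 ^ i \<le> n \<and> (k = 2 ^ i - 1 \<or> k = 2 ^ i - 2)}"

lemma checks_window:
  assumes "k \<in> checks n"
  shows "2 ^ Suc k \<le> n"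
proof -
  from assms obtain i where i: "1 \<le> i" "2 ^ 2 ^ i \<le> n" "k = 2 ^ i - 1 \<or> k = 2 ^ i - 2"
    by (auto simp: checks_def)
  have "(2::nat) ^ 1 \<le> 2 ^ i" using i(1) by (intro power_increasing) auto
  then have "Suc k \<le> 2 ^ i" using i(3) by auto
  then have "(2::nat) ^ Suc k \<le> 2 ^ 2 ^ i" by (intro power_increasing) auto
  with i show ?thesis by linarith
qed

lemma checks_mono: "m \<le> n \<Longrightarrow> checks m \<subseteq> checks n"
  unfolding checks_def by (auto intro: order_trans)

text \<open>The windows of the first \<open>i\<close> scales, which is the form in which they can be counted inductively.\<close>

definition checks_upto :: "nat \<Rightarrow> nat set" where
  "checks_upto i = (\<Union>l\<in>{1..i}. {2 ^ l - 1, 2 ^ l - 2})"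

lemma checks_upto_less: "k \<in> checks_upto i \<Longrightarrow> k < 2 ^ i"
proof -
  assume "k \<in> checks_upto i"
  then obtain l where l: "1 \<le> l" "l \<le> i" "k = 2 ^ l - 1 \<or> k = 2 ^ l - 2"
    by (auto simp: checks_upto_def)
  have "(2::nat) ^ l \<le> 2 ^ i" using l by (intro power_increasing) auto
  moreover have "(0::nat) < 2 ^ l" by simp
  ultimately show ?thesis using l by linarith
qed

lemma finite_checks_upto [simp]: "finite (checks_upto i)"
  by (simp add: checks_upto_def)

lemma checks_upto_0 [simp]: "checks_upto 0 = {}"
  by (simp add: checks_upto_def)

lemma checks_upto_Suc:
  "checks_upto (Suc i) = insert (2 ^ Suc i - 1) (insert (2 ^ Suc i - 2) (checks_upto i))"
proof -
  have "{1..Suc i} = insert (Suc i) {1..i}" by auto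
  then show ?thesis by (simp add: checks_upto_def)
qed

lemma card_checks_upto: "card (checks_upto i) \<le> 2 * i"
proof (induction i)
  case (Suc i)
  then show ?case
    unfolding checks_upto_Suc
    by (intro order_trans[OF card_insert_le_m1] order_trans[OF card_insert_le_m1]) auto
qed simp

text \<open>
  The total redundancy: scale \<open>l\<close> contributes \<open>(2 ^ l - 1) + (2 ^ l - 2)\<close>, and \<open>\<Sum>k\<close> is the
  exponent of the density of the code.
\<close>

lemma sum_checks_upto: "(\<Sum>k\<in>checks_upto i. k) + 4 + 3 * i = 2 ^ (i + 2)"
proof (induction i)
  case (Suc i)
  have a: "2 ^ Suc i - 2 \<notin> checks_upto i"
  proof (cases i)
    case (Suc j)
    have "(2::nat) ^ 1 \<le> 2 ^ i" using Suc by (intro power_increasing) auto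
    then have "(2::nat) ^ i \<le> 2 ^ Suc i - 2" by simp
    then show ?thesis using checks_upto_less[of "2 ^ Suc i - 2" i] by auto
  qed simp
  have "(2::nat) ^ i \<le> 2 ^ Suc i - 1" by (simp add: Suc_leI)
  then have b: "2 ^ Suc i - 1 \<notin> checks_upto i"
    using checks_upto_less[of "2 ^ Suc i - 1" i] by auto
  have c: "(2::nat) ^ Suc i \<ge> 2" by simp
  then have "(2::nat) ^ Suc i - 1 \<noteq> 2 ^ Suc i - 2" by linarith
  then have "(\<Sum>k\<in>checks_upto (Suc i). k)
     = (2 ^ Suc i - 1) + ((2 ^ Suc i - 2) + (\<Sum>k\<in>checks_upto i. k))"
    unfolding checks_upto_Suc using a b by (subst sum.insert; simp)
  then show ?case using Suc c by simp
qed simp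

lemma checks_eq:
  assumes "n < 2 ^ 2 ^ Suc i" "i = 0 \<or> 2 ^ 2 ^ i \<le> n"
  shows "checks n = checks_upto i"
proof -
  have "(1 \<le> l \<and> 2 ^ 2 ^ l \<le> n) \<longleftrightarrow> (1 \<le> l \<and> l \<le> i)" for l
  proof
    assume l: "1 \<le> l \<and> 2 ^ 2 ^ l \<le> n"
    have "\<not> Suc i \<le> l"
    proof
      assume "Suc i \<le> l"
      then have "(2::nat) ^ 2 ^ Suc i \<le> 2 ^ 2 ^ l" by (intro power_increasing) auto
      with l assms show False by linarith
    qed
    with l show "1 \<le> l \<and> l \<le> i" by auto
  next
    assume l: "1 \<le> l \<and> l \<le> i"
    then have "(2::nat) ^ 2 ^ l \<le> 2 ^ 2 ^ i" by (intro power_increasing) auto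
    moreover have "2 ^ 2 ^ i \<le> n" using l assms(2) by auto
    ultimately show "1 \<le> l \<and> 2 ^ 2 ^ l \<le> n" using l by linarith
  qed
  then have "checks n = {k. \<exists>i'. (1 \<le> i' \<and> i' \<le> i) \<and> (k = 2 ^ i' - 1 \<or> k = 2 ^ i' - 2)}"
    unfolding checks_def by blast
  then show ?thesis unfolding checks_upto_def by auto
qed

lemma double_exp_bracket:
  obtains i where "n < (2::nat) ^ 2 ^ Suc i" "i = 0 \<or> 2 ^ 2 ^ i \<le> n"
proof -
  have "n < (2::nat) ^ 2 ^ Suc n"
  proof -
    have "n < (2::nat) ^ n" "n \<le> 2 ^ Suc n" by (simp_all add: less_imp_le less_exp le_SucI mult_2 trans_le_add1)
    then show ?thesis by (meson less_le_trans one_le_numeral power_increasing)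
  qed
  then have ex: "\<exists>i. n < (2::nat) ^ 2 ^ Suc i" by blast
  define i where "i = (LEAST i. n < (2::nat) ^ 2 ^ Suc i)"
  have "n < (2::nat) ^ 2 ^ Suc i" unfolding i_def using ex by (rule LeastI_ex)
  moreover have "i = 0 \<or> 2 ^ 2 ^ i \<le> n"
  proof (cases i)
    case (Suc j)
    then have "\<not> n < (2::nat) ^ 2 ^ Suc j" using not_less_Least[of j "\<lambda>i. n < (2::nat) ^ 2 ^ Suc i"] i_def by simp
    with Suc show ?thesis by auto
  qed simp
  ultimately show ?thesis using that by blast
qed

lemma finite_checks [simp]: "finite (checks n)"
  by (rule double_exp_bracket[of n]) (auto simp: checks_eq)

text \<open>
  The summand \<open>1\<close> pays for the marker, which takes up one letter of the \<open>m > n\<close> letters available.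
\<close>

lemma card_checks:
  assumes "n < m"
  shows "1 + card (checks n) \<le> mistake_loglog m"
proof (rule double_exp_bracket[of n])
  fix i assume i: "n < (2::nat) ^ 2 ^ Suc i" "i = 0 \<or> 2 ^ 2 ^ i \<le> n"
  have card: "card (checks n) \<le> 2 * i" using checks_eq[OF i] card_checks_upto by auto
  show ?thesis
  proof (cases "i = 0")
    case True
    with card show ?thesis by (auto simp: mistake_loglog_def)
  next
    case False
    with i have le: "2 ^ 2 ^ i \<le> m" using assms by auto
    have "(2::nat) ^ 1 \<le> 2 ^ 2 ^ i" by (intro power_increasing) auto
    with le have m2: "m \<ge> 2" by auto
    have "2 powr (2 powr real i) = real (2 ^ 2 ^ i)"
      by (simp add: powr_realpow[symmetric])
    also have "\<dots> \<le> real m" using le by (simp only: of_nat_le_iff)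
    finally have "2 powr real i \<le> log 2 m" using m2 by (simp add: le_log_iff)
    moreover have "0 < log 2 m" using m2 by simp
    ultimately have "real i \<le> log 2 (log 2 m)" by (simp add: le_log_iff)
    then have "i \<le> nat \<lfloor>log 2 (log 2 m)\<rfloor>" by linarith
    with card m2 show ?thesis by (simp add: mistake_loglog_def)
  qed
qed

text \<open>The proportion of code words: a window with \<open>2 ^ k\<close> syndromes cuts it down by \<open>1 / 2 ^ k\<close>.\<close>

definition check_density :: "nat \<Rightarrow> real" where
  "check_density n = (\<Prod>k\<in>checks n. 1 / 2 ^ k)"

lemma check_density_eq:
  assumes "n < 2 ^ 2 ^ Suc i" "i = 0 \<or> 2 ^ 2 ^ i \<le> n"
  shows "check_density n = 2 ^ (3 * i + 4) / 2 ^ (2 ^ (i + 2))"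
proof -
  have "check_density n = 1 / 2 ^ (\<Sum>k\<in>checks_upto i. k)"
    unfolding check_density_def checks_eq[OF assms] by (simp add: power_sum prod_dividef)
  also have "\<dots> = 2 ^ (3 * i + 4) / 2 ^ ((\<Sum>k\<in>checks_upto i. k) + 4 + 3 * i)"
    by (simp add: power_add)
  finally show ?thesis by (simp only: sum_checks_upto)
qed

lemma check_density_nonneg: "0 \<le> check_density n"
  unfolding check_density_def by (intro prod_nonneg) auto

text \<open>
  On the lengths from \<open>2 ^ 2 ^ i\<close> (from \<open>0\<close>, if \<open>i = 0\<close>) to \<open>N = 2 ^ 2 ^ (i + 1)\<close> the density is \<open>2 ^ (3 * i + 4) / N\<^sup>2\<close>, so
  they contribute at most \<open>2 ^ (3 * i + 4) / N\<close>.  As \<open>N\<close> grows doubly exponentially, this is at most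
  \<open>64 / 2 ^ i\<close>, a geometric series with sum \<open>128\<close>.
\<close>

lemma sum_check_density_le: "(\<Sum>n<m. check_density n) \<le> 128"
proof -
  have lin: "4 * i \<le> 2 ^ Suc i + (2::nat)" for i
  proof (induction i)
    case (Suc i)
    then show ?case by (cases "i \<le> 1") (auto simp: le_Suc_eq numeral_eq_Suc Suc_le_eq intro: le_trans)
  qed simp
  have block: "(\<Sum>n = a..<2 ^ 2 ^ Suc i. check_density n) \<le> 64 / 2 ^ i"
    if "i = 0 \<or> a \<ge> 2 ^ 2 ^ i" for a i
  proof -
    have "(\<Sum>n = a..<2 ^ 2 ^ Suc i. check_density n)
        \<le> (\<Sum>n = a..<2 ^ 2 ^ Suc i. 2 ^ (3 * i + 4) / 2 ^ (2 ^ (i + 2)))"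
      using that by (intro sum_mono eq_refl check_density_eq) auto
    also have "\<dots> \<le> real (2 ^ 2 ^ Suc i) * (2 ^ (3 * i + 4) / 2 ^ (2 ^ (i + 2)))"
      unfolding sum_constant by (intro mult_right_mono) auto
    also have "\<dots> = 2 ^ (2 ^ Suc i) * 2 ^ (3 * i + 4) / 2 ^ (2 ^ Suc i + 2 ^ Suc i)"
      by simp
    also have "\<dots> = 2 ^ (3 * i + 4) / 2 ^ (2 ^ Suc i)"
      unfolding power_add by simp
    also have "\<dots> \<le> 64 / 2 ^ i"
    proof -
      have "(2::real) ^ (3 * i + 4) * 2 ^ i = 2 ^ (4 * i + 4)"
        by (simp flip: power_add)
      also have "\<dots> \<le> 2 ^ (6 + 2 ^ Suc i)"
        using lin[of i] by (intro power_increasing) auto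
      also have "\<dots> = 64 * 2 ^ (2 ^ Suc i)" by (simp only: power_add) simp
      finally show ?thesis by (simp add: field_simps del: power_Suc)
    qed
    finally show ?thesis .
  qed
  have blocks: "(\<Sum>n<2 ^ 2 ^ Suc i. check_density n) \<le> 128 - 64 / 2 ^ i" for i
  proof (induction i)
    case 0
    show ?case using block[of 0 0] by (simp add: atLeast0LessThan)
  next
    case (Suc i)
    have "(2::nat) ^ 2 ^ Suc i \<le> 2 ^ 2 ^ Suc (Suc i)" by (intro power_increasing) auto
    then have "(\<Sum>n<2 ^ 2 ^ Suc (Suc i). check_density n) =
       (\<Sum>n<2 ^ 2 ^ Suc i. check_density n) + (\<Sum>n = 2 ^ 2 ^ Suc i..<2 ^ 2 ^ Suc (Suc i). check_density n)"
      unfolding lessThan_atLeast0 by (intro sum.atLeastLessThan_concat[symmetric]) simp_all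
    also have "\<dots> \<le> (128 - 64 / 2 ^ i) + 64 / 2 ^ Suc i"
      by (intro add_mono Suc block) auto
    also have "\<dots> = 128 - 64 / 2 ^ Suc i" by (simp add: field_simps)
    finally show ?case .
  qed
  obtain i where "m < (2::nat) ^ 2 ^ Suc i" using double_exp_bracket[of m] by blast
  then have "(\<Sum>n<m. check_density n) \<le> (\<Sum>n<2 ^ 2 ^ Suc i. check_density n)"
    using check_density_nonneg by (intro sum_mono2) auto
  also have "\<dots> \<le> 128 - 64 / 2 ^ i" by (rule blocks)
  also have "\<dots> \<le> 128" by simp
  finally show ?thesis .
qed

section \<open>Closable words\<close>

text \<open>
  Positions are counted from the right end, where the marker will be placed; this is what makes
  the condition pass to suffixes.
\<close>

definition closable :: "nat list \<Rightarrow> bool" where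
  "closable u \<longleftrightarrow> (\<forall>k\<in>checks (length u). syndrome k ((!) (rev u)) = 0)"

lemma closable_Nil [simp]: "closable []"
  by (auto simp: closable_def checks_def)

lemma closable_suffix:
  assumes "closable (a @ b)"
  shows "closable b"
  unfolding closable_def
proof
  fix k assume k: "k \<in> checks (length b)"
  then have "k \<in> checks (length (a @ b))" using checks_mono[of "length b" "length (a @ b)"] by auto
  then have "syndrome k ((!) (rev (a @ b))) = 0" using assms by (auto simp: closable_def)
  moreover have "syndrome k ((!) (rev (a @ b))) = syndrome k ((!) (rev b))"
    using checks_window[OF k] by (intro syndrome_cong) (auto simp: nth_append)
  ultimately show "syndrome k ((!) (rev b)) = 0" by simp
qed

definition flip_word :: "nat set \<Rightarrow> nat list \<Rightarrow> nat list" where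
  "flip_word P u = rev (map (flip_on P ((!) (rev u))) [0..<length u])"

lemma length_flip_word [simp]: "length (flip_word P u) = length u"
  by (simp add: flip_word_def)

lemma rev_flip_word_nth:
  "r < length u \<Longrightarrow> rev (flip_word P u) ! r = flip_on P ((!) (rev u)) r"
  by (simp add: flip_word_def)

lemma flip_word_flip_word [simp]: "flip_word P (flip_word P u) = u"
proof -
  have "rev (flip_word P (flip_word P u)) = rev u"
    by (rule nth_equalityI) (auto simp: rev_flip_word_nth flip_on_def)
  then show ?thesis by simp
qed

text \<open>
  Colours \<open>1\<close> and \<open>2\<close> will be used, as colour \<open>0\<close> contains the marker.  The size is even, so that \<open>flip\<close> preserves colours, and it is large
  enough to absorb the bound \<open>128\<close> on the sum of the densities in the count of legal words.
\<close>

definition letters :: "nat \<Rightarrow> nat set" where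
  "letters t = {512 * t..<512 * t + 512}"

lemma finite_letters [simp]: "finite (letters t)"
  and card_letters [simp]: "card (letters t) = 512"
  and letters_nonempty [simp]: "letters t \<noteq> {}"
  by (auto simp: letters_def)

lemma flip_letters: "c \<in> letters t \<Longrightarrow> flip c \<in> letters t"
proof (cases "even c")
  case True
  assume c: "c \<in> letters t"
  from True obtain b where b: "c = 2 * b" by blast
  with c have "b < 256 * t + 256" by (simp add: letters_def)
  with b c show ?thesis by (simp add: letters_def flip_def)
next
  case False
  assume c: "c \<in> letters t"
  from False obtain b where b: "c = 2 * b + 1" by (blast elim: oddE)
  with c have "256 * t \<le> b" by (simp add: letters_def)
  with b c show ?thesis by (simp add: letters_def flip_def)
qed

lemma set_flip_word:
  assumes "set u \<subseteq> letters t"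
  shows "set (flip_word P u) \<subseteq> letters t"
proof -
  have "rev u ! r \<in> letters t" if "r < length u" for r
    using that assms by (metis length_rev nth_mem set_rev subsetD)
  then show ?thesis by (auto simp: flip_word_def flip_on_def flip_letters)
qed

lemma hamming_flip_word:
  assumes "finite P"
  shows "hamming (flip_word P u) u \<le> card P"
proof -
  have "{i. i < length u \<and> flip_word P u ! i \<noteq> u ! i} \<subseteq> (\<lambda>p. length u - 1 - p) ` P"
  proof
    fix i assume "i \<in> {i. i < length u \<and> flip_word P u ! i \<noteq> u ! i}"
    then have i: "i < length u" "flip_word P u ! i \<noteq> u ! i" by auto
    let ?r = "length u - 1 - i"
    have "rev (flip_word P u) ! ?r = flip_word P u ! i" "rev u ! ?r = u ! i"
      using i by (auto simp: rev_nth)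
    with i rev_flip_word_nth[of ?r u P] have "?r \<in> P"
      by (auto simp: flip_on_def split: if_splits)
    with i show "i \<in> (\<lambda>p. length u - 1 - p) ` P" by (intro image_eqI[of _ _ ?r]) auto
  qed
  then have "card {i. i < length u \<and> flip_word P u ! i \<noteq> u ! i} \<le> card P"
    using assms by (meson card_image_le card_mono finite_imageI le_trans)
  then show ?thesis by (simp add: hamming_def)
qed

lemma syndrome_flip_word:
  assumes "k \<in> checks (length u)" "\<And>l. l \<in> checks (length u) \<Longrightarrow> s l < 2 ^ l"
  shows "syndrome k ((!) (rev (flip_word ((\<lambda>l. 2 ^ l + s l) ` checks (length u)) u)))
    = xor (syndrome k ((!) (rev u))) (s k)"
proof -
  let ?P = "(\<lambda>l. 2 ^ l + s l) ` checks (length u)"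
  have "syndrome k ((!) (rev (flip_word ?P u))) = syndrome k (flip_on ?P ((!) (rev u)))"
    using checks_window[OF assms(1)] by (intro syndrome_cong) (auto simp: rev_flip_word_nth)
  also have "\<dots> = xor (syndrome k ((!) (rev u))) (s k)"
    using assms by (rule syndrome_flip_on)
  finally show ?thesis .
qed

text \<open>Flipping each imposed window at the offset given by its own syndrome makes all syndromes vanish.\<close>

lemma correction:
  assumes "set u \<subseteq> letters t"
  obtains v where "length v = length u" "set v \<subseteq> letters t" "closable v"
    "hamming v u \<le> card (checks (length u))"
proof -
  define s where "s l = syndrome l ((!) (rev u))" for l
  define P where "P = (\<lambda>l. 2 ^ l + s l) ` checks (length u)"
  have "closable (flip_word P u)"
    unfolding closable_def P_def using syndrome_flip_word[of _ u s]
    by (auto simp: s_def syndrome_less)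
  moreover have "hamming (flip_word P u) u \<le> card (checks (length u))"
    unfolding P_def by (rule order_trans[OF hamming_flip_word card_image_le]) auto
  ultimately show ?thesis using set_flip_word[OF assms] by (intro that[of "flip_word P u"]) auto
qed

text \<open>
  The sphere-packing count: a closable word together with a choice of one offset per window
  determines the word obtained by flipping there, and conversely the syndromes of the
  latter recover the offsets and hence the closable word.
\<close>

lemma card_closable_words:
  "real (card {u. set u \<subseteq> letters t \<and> closable u \<and> length u = n}) \<le> 512 ^ n * check_density n"
proof -
  let ?G = "{u. set u \<subseteq> letters t \<and> closable u \<and> length u = n}"
  let ?W = "{u. set u \<subseteq> letters t \<and> length u = n}"
  let ?S = "PiE (checks n) (\<lambda>k. {..<(2::nat) ^ k})"
  define F where "F = (\<lambda>(u, s). flip_word ((\<lambda>l. 2 ^ l + s l) ` checks n) u)"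
  have fW: "finite ?W" "card ?W = 512 ^ n"
    using finite_lists_length_eq[of "letters t" n] card_lists_length_eq[of "letters t" n] by simp_all
  have syn: "syndrome k ((!) (rev (F (u, s)))) = s k"
    if "u \<in> ?G" "s \<in> ?S" "k \<in> checks n" for u s k
    using that syndrome_flip_word[of k u s] by (auto simp: F_def closable_def PiE_iff)
  have "inj_on F (?G \<times> ?S)"
  proof (rule inj_onI)
    fix a b assume a: "a \<in> ?G \<times> ?S" and b: "b \<in> ?G \<times> ?S" and eq: "F a = F b"
    obtain u s where [simp]: "a = (u, s)" by (cases a)
    obtain v r where [simp]: "b = (v, r)" by (cases b)
    have "s k = r k" if "k \<in> checks n" for k
      using a b eq that syn[of u s k] syn[of v r k] by auto
    then have "s = r" using a b by (intro PiE_ext[of s "checks n" _ r]) auto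
    moreover from this eq have "u = v"
      unfolding F_def by (metis (no_types, lifting) \<open>a = (u, s)\<close> \<open>b = (v, r)\<close> case_prod_conv flip_word_flip_word)
    ultimately show "a = b" by simp
  qed
  moreover have "F ` (?G \<times> ?S) \<subseteq> ?W"
    using set_flip_word by (auto simp: F_def)
  ultimately have "card (?G \<times> ?S) \<le> card ?W"
    using fW(1) by (intro card_inj_on_le)
  then have "card ?G * (\<Prod>k\<in>checks n. 2 ^ k) \<le> 512 ^ n"
    by (simp add: card_cartesian_product card_PiE fW(2))
  then have "real (card ?G * (\<Prod>k\<in>checks n. 2 ^ k)) \<le> real (512 ^ n)"
    by (simp only: of_nat_le_iff)
  then have "real (card ?G) * (\<Prod>k\<in>checks n. 2 ^ k) \<le> 512 ^ n" by simp
  moreover have "(0::real) < (\<Prod>k\<in>checks n. 2 ^ k)" by (intro prod_pos) auto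
  ultimately show ?thesis
    by (simp add: check_density_def prod_dividef field_simps)
qed

section \<open>Legal words\<close>

definition monochrome :: "nat list \<Rightarrow> bool" where
  "monochrome u \<longleftrightarrow> set u \<subseteq> letters 1 \<or> set u \<subseteq> letters 2"

text \<open>
  Both conditions quantify over all marker-free factors, not only over maximal runs.
  This makes legality visibly hereditary, and it amounts to the same because
  monochrome words and closable words are closed under suffixes.
\<close>

definition legal :: "nat list \<Rightarrow> bool" where
  "legal w \<longleftrightarrow>
     (\<forall>p u s. w = p @ u @ s \<and> 0 \<notin> set u \<longrightarrow> monochrome u) \<and>
     (\<forall>p u s. w = p @ u @ 0 # s \<and> 0 \<notin> set u \<longrightarrow> closable u)"

lemma zero_notin_letters: "0 < t \<Longrightarrow> 0 \<notin> letters t"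
  by (simp add: letters_def)

lemma monochrome_zero: "monochrome u \<Longrightarrow> 0 \<notin> set u"
  using zero_notin_letters by (auto simp: monochrome_def)

lemma monochrome_Nil [simp]: "monochrome []"
  by (simp add: monochrome_def)

lemma monochrome_factor: "monochrome (p @ u @ s) \<Longrightarrow> monochrome u"
  by (auto simp: monochrome_def)

lemma legal_factor:
  assumes "legal (p @ w @ s)"
  shows "legal w"
  unfolding legal_def
proof (intro conjI allI impI)
  fix p' u s' assume "w = p' @ u @ s' \<and> 0 \<notin> set u"
  then have "p @ w @ s = (p @ p') @ u @ (s' @ s)" "0 \<notin> set u" by auto
  with assms show "monochrome u" unfolding legal_def by blast
next
  fix p' u s' assume "w = p' @ u @ 0 # s' \<and> 0 \<notin> set u"
  then have "p @ w @ s = (p @ p') @ u @ 0 # (s' @ s)" "0 \<notin> set u" by auto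
  with assms show "closable u" unfolding legal_def by blast
qed

lemma legal_monochrome:
  assumes "monochrome u"
  shows "legal u"
  using assms monochrome_zero[OF assms] monochrome_factor by (auto simp: legal_def)

text \<open>A marker-free factor cannot straddle a marker.\<close>

lemma append_zero_split:
  assumes "v @ 0 # w = p @ u @ s" "(0::nat) \<notin> set u"
  shows "(\<exists>s'. v = p @ u @ s' \<and> s = s' @ 0 # w) \<or> (\<exists>p'. w = p' @ u @ s)"
  using assms
  by (auto simp: append_eq_append_conv2 append_eq_Cons_conv Cons_eq_append_conv)

lemma legal_join:
  assumes "legal (v @ [0])" "legal w"
  shows "legal (v @ 0 # w)"
  unfolding legal_def
proof (intro conjI allI impI; elim conjE)
  fix p u s assume *: "v @ 0 # w = p @ u @ s" "0 \<notin> set u"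
  from append_zero_split[OF *] show "monochrome u"
  proof (elim disjE exE conjE)
    fix s' assume "v = p @ u @ s'"
    then have "v @ [0] = p @ u @ (s' @ [0])" by simp
    with assms(1) *(2) show ?thesis unfolding legal_def by blast
  next
    fix p' assume "w = p' @ u @ s"
    with assms(2) *(2) show ?thesis unfolding legal_def by blast
  qed
next
  fix p u s assume *: "v @ 0 # w = p @ u @ 0 # s" "0 \<notin> set u"
  from append_zero_split[OF *] show "closable u"
  proof (elim disjE exE conjE)
    fix s' assume s': "v = p @ u @ s'" "0 # s = s' @ 0 # w"
    then have "\<exists>s''. v @ [0] = p @ u @ 0 # s''" by (cases s') auto
    with assms(1) *(2) show ?thesis unfolding legal_def by blast
  next
    fix p' assume "w = p' @ u @ 0 # s"
    with assms(2) *(2) show ?thesis unfolding legal_def by blast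
  qed
qed

lemma legal_zero: "legal [0]"
  by (auto simp: legal_def append_eq_Cons_conv Cons_eq_append_conv)

lemma legal_Cons_zero: "legal w \<Longrightarrow> legal (0 # w)"
  using legal_join[of "[]" w] legal_zero by simp

lemma legal_block:
  assumes "monochrome u" "closable u"
  shows "legal (u @ [0])"
  unfolding legal_def
proof (intro conjI allI impI; elim conjE)
  fix p u' s assume *: "u @ [0] = p @ u' @ s" "0 \<notin> set u'"
  from append_zero_split[OF *] show "monochrome u'"
    using assms monochrome_factor by auto
next
  fix p u' s assume *: "u @ [0] = p @ u' @ 0 # s" "0 \<notin> set u'"
  from append_zero_split[OF *] show "closable u'"
    using assms monochrome_zero[OF assms(1)] closable_suffix by (auto simp: Cons_eq_append_conv)
qed

lemma last_run:
  obtains q u where "w = q @ u" "0 \<notin> set u" "q = [] \<or> (\<exists>q'. q = q' @ [0::nat])"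
proof (cases "0 \<in> set w")
  case True
  then obtain a b where "w = a @ 0 # b" "0 \<notin> set b" by (metis split_list_last)
  then show ?thesis using that[of "a @ [0]" b] by auto
qed (use that[of "[]" w] in auto)

text \<open>
  Repeating the last letter extends a legal word to the right without placing a new marker after its
  last run, so that this run need not be closable.
\<close>

lemma legal_snoc_last:
  assumes "legal w" "w \<noteq> []"
  shows "legal (w @ replicate n (last w))"
proof -
  obtain q u where w: "w = q @ u" "0 \<notin> set u" "q = [] \<or> (\<exists>q'. q = q' @ [0::nat])"
    by (rule last_run)
  have u: "monochrome u" using assms(1) w(1,2) unfolding legal_def by (metis append_Nil2)
  show ?thesis
  proof (cases "u = []")
    case True
    with w assms obtain q' where q': "w = q' @ [0]" by auto
    have "legal (replicate n 0)"
      by (induction n) (auto simp: legal_Cons_zero legal_monochrome)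
    then show ?thesis using legal_join[of q' "replicate n 0"] q' assms by simp
  next
    case False
    then have "last u \<in> set u" by simp
    then have "monochrome (u @ replicate n (last u))" using u by (auto simp: monochrome_def)
    then have l: "legal (u @ replicate n (last w))" using w False by (simp add: legal_monochrome)
    from w(3) show ?thesis
    proof (elim disjE exE)
      fix q' assume q': "q = q' @ [0]"
      have "legal (q' @ [0])" using legal_factor[of "[]" q u] assms w q' by simp
      from legal_join[OF this l] show ?thesis using w q' by simp
    qed (use l w in simp)
  qed
qed

lemma legal_finite: "legal w \<Longrightarrow> set w \<subseteq> insert 0 (letters 1 \<union> letters 2)"
proof
  fix c assume "legal w" "c \<in> set w"
  then obtain p s where "w = p @ [c] @ s" by (metis append_Cons append_Nil split_list)
  with \<open>legal w\<close> have "c \<noteq> 0 \<longrightarrow> monochrome [c]" unfolding legal_def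
    by (metis empty_iff list.set(1) set_ConsD)
  then show "c \<in> insert 0 (letters 1 \<union> letters 2)" by (auto simp: monochrome_def)
qed

lemma hamming_append:
  assumes "length a = length b"
  shows "hamming (a @ c) (b @ d) = hamming a b + card {i. i < length c \<and> c ! i \<noteq> d ! i}"
proof -
  let ?n = "length a"
  have "{i. i < length (a @ c) \<and> (a @ c) ! i \<noteq> (b @ d) ! i} =
     {i. i < ?n \<and> a ! i \<noteq> b ! i} \<union> (\<lambda>i. i + ?n) ` {i. i < length c \<and> c ! i \<noteq> d ! i}" (is "_ = ?L \<union> ?R")
  proof (intro set_eqI iffI)
    fix i assume "i \<in> {i. i < length (a @ c) \<and> (a @ c) ! i \<noteq> (b @ d) ! i}"
    then show "i \<in> ?L \<union> ?R"
      using assms by (cases "i < ?n") (auto simp: nth_append intro!: image_eqI[of _ _ "i - ?n"])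
  qed (use assms in \<open>auto simp: nth_append\<close>)
  moreover have "?L \<inter> ?R = {}" by auto
  ultimately have "hamming (a @ c) (b @ d) = card ?L + card ?R"
    unfolding hamming_def by (simp add: card_Un_disjoint)
  also have "card ?R = card {i. i < length c \<and> c ! i \<noteq> d ! i}" by (intro card_image) auto
  finally show ?thesis by (simp add: hamming_def)
qed

text \<open>
  The last letter of \<open>w\<close> becomes a marker, unless it is one already, and what remains of the last run
  is corrected to a closable word.  The marker shields \<open>w'\<close>, whose first run is then as legal as before.
\<close>

lemma legal_left_specification:
  assumes "legal w" "legal w'"
  obtains v where "length v = length w" "legal (v @ w')"
    "w \<noteq> [] \<Longrightarrow> hamming v w \<le> mistake_loglog (length w)"
proof -
  obtain q u where w: "w = q @ u" "0 \<notin> set u" "q = [] \<or> (\<exists>q'. q = q' @ [0::nat])"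
    by (rule last_run)
  have u: "monochrome u" using assms(1) w(1,2) unfolding legal_def by (metis append_Nil2)
  have join: "legal (q @ z)" if "legal z" for z
    using w(3)
  proof (elim disjE exE)
    fix q' assume q': "q = q' @ [0]"
    have "legal (q' @ [0])" using legal_factor[of "[]" q u] assms w q' by simp
    from legal_join[OF this that] show ?thesis using q' by simp
  qed (use that in simp)
  show ?thesis
  proof (cases "u = []")
    case True
    have "hamming w w = 0" by (simp add: hamming_def)
    then show ?thesis using join[OF assms(2)] w True by (intro that[of w]) auto
  next
    case False
    then obtain u1 c where u1: "u = u1 @ [c]" by (metis rev_exhaust)
    from u u1 obtain t where t: "t = 1 \<or> t = 2" "set u1 \<subseteq> letters t" by (auto simp: monochrome_def)
    from correction[OF t(2)] obtain v1 where v1: "length v1 = length u1" "set v1 \<subseteq> letters t"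
      "closable v1" "hamming v1 u1 \<le> card (checks (length u1))" by metis
    have "legal (v1 @ [0])" using v1 t by (intro legal_block) (auto simp: monochrome_def)
    from join[OF legal_join[OF this assms(2)]] have "legal ((q @ v1 @ [0]) @ w')" by simp
    moreover have "hamming (q @ v1 @ [0]) w \<le> mistake_loglog (length w)"
    proof -
      have "card {i. i < length [0::nat] \<and> [0] ! i \<noteq> [c] ! i} \<le> card {0::nat}"
        by (intro card_mono) auto
      then have "hamming (v1 @ [0]) u \<le> card (checks (length u1)) + 1"
        using v1 u1 by (simp add: hamming_append)
      moreover have "hamming (q @ v1 @ [0]) w = hamming (v1 @ [0]) u"
        using w by (simp add: hamming_append) (simp add: hamming_def)
      moreover have "1 + card (checks (length u1)) \<le> mistake_loglog (length w)"
        using w u1 by (intro card_checks) auto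
      ultimately show ?thesis by linarith
    qed
    ultimately show ?thesis using w u1 v1 by (intro that[of "q @ v1 @ [0]"]) auto
  qed
qed

lemma card_monochrome: "card {u. monochrome u \<and> length u = n} \<le> 2 * 512 ^ n"
proof -
  have "{u. monochrome u \<and> length u = n} =
    {u. set u \<subseteq> letters 1 \<and> length u = n} \<union> {u. set u \<subseteq> letters 2 \<and> length u = n}"
    by (auto simp: monochrome_def)
  also have "card \<dots> \<le> 512 ^ n + 512 ^ n"
    by (rule order_trans[OF card_Un_le]) (simp add: card_lists_length_eq)
  finally show ?thesis by simp
qed

lemma card_monochrome_closable:
  "real (card {u. monochrome u \<and> closable u \<and> length u = n}) \<le> 2 * (512 ^ n * check_density n)"
proof -
  have "{u. monochrome u \<and> closable u \<and> length u = n} =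
    {u. set u \<subseteq> letters 1 \<and> closable u \<and> length u = n} \<union> {u. set u \<subseteq> letters 2 \<and> closable u \<and> length u = n}"
    by (auto simp: monochrome_def)
  then have "card {u. monochrome u \<and> closable u \<and> length u = n} \<le>
    card {u. set u \<subseteq> letters 1 \<and> closable u \<and> length u = n} + card {u. set u \<subseteq> letters 2 \<and> closable u \<and> length u = n}"
    by (simp only: card_Un_le)
  with card_closable_words[of 1 n] card_closable_words[of 2 n] show ?thesis by linarith
qed

lemma finite_legal [simp]: "finite {w. legal w \<and> length w = n}"
proof (rule finite_subset)
  show "{w. legal w \<and> length w = n} \<subseteq> {w. set w \<subseteq> insert 0 (letters 1 \<union> letters 2) \<and> length w = n}"
    using legal_finite by auto
qed (intro finite_lists_length_eq; simp)

text \<open>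
  Cutting at the first marker, the number \<open>T n\<close> of legal words satisfies
  \<open>T n \<le> 2 * 512 ^ n + (\<Sum>j<n. 2 * 512 ^ j * check_density j * T (n - 1 - j))\<close>.  If \<open>T m \<le> 4 * 512 ^ m\<close>
  for \<open>m < n\<close>, the sum is at most \<open>8 * 128 * 512 ^ (n - 1) = 2 * 512 ^ n\<close>, and the induction closes.
\<close>

lemma card_legal: "real (card {w. legal w \<and> length w = n}) \<le> 4 * 512 ^ n"
proof (induction n rule: less_induct)
  case (less n)
  let ?T = "\<lambda>n. {w. legal w \<and> length w = n}"
  let ?G = "\<lambda>j. {u. monochrome u \<and> closable u \<and> length u = j}"
  let ?H = "\<lambda>j. (\<lambda>(u, w). u @ 0 # w) ` (?G j \<times> ?T (n - 1 - j))"
  have fG: "finite (?G j)" for j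
    by (rule finite_subset[OF _ finite_legal[of j]]) (auto simp: legal_monochrome)
  have fP: "finite {u. monochrome u \<and> length u = n}"
    by (rule finite_subset[OF _ finite_legal[of n]]) (auto simp: legal_monochrome)
  have "?T n \<subseteq> {u. monochrome u \<and> length u = n} \<union> (\<Union>j<n. ?H j)"
  proof
    fix w assume w: "w \<in> ?T n"
    show "w \<in> {u. monochrome u \<and> length u = n} \<union> (\<Union>j<n. ?H j)"
    proof (cases "0 \<in> set w")
      case True
      then obtain u s where us: "w = u @ 0 # s" "0 \<notin> set u" by (metis split_list_first)
      have "monochrome u" "closable u"
        using w us unfolding legal_def mem_Collect_eq by (metis append_Nil)+
      moreover have "legal s" using w us legal_factor[of "u @ [0]" s "[]"] by simp
      ultimately have "w \<in> ?H (length u)"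
        using w us by (intro image_eqI[of _ _ "(u, s)"]) auto
      moreover have "length u < n" using w us by auto
      ultimately show ?thesis by blast
    next
      case False
      then have "monochrome w" using w unfolding legal_def mem_Collect_eq by (metis append_Nil append_Nil2)
      then show ?thesis using w by auto
    qed
  qed
  then have "card (?T n) \<le> card ({u. monochrome u \<and> length u = n} \<union> (\<Union>j<n. ?H j))"
    using fG fP by (intro card_mono finite_UnI finite_UN_I finite_imageI finite_cartesian_product finite_legal) auto
  also have "\<dots> \<le> card {u. monochrome u \<and> length u = n} + (\<Sum>j<n. card (?H j))"
    by (rule order_trans[OF card_Un_le add_left_mono[OF card_UN_le]]) simp
  finally have "real (card (?T n)) \<le> real (card {u. monochrome u \<and> length u = n}) + (\<Sum>j<n. real (card (?H j)))"
    by (simp flip: of_nat_sum of_nat_add)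
  also have "\<dots> \<le> 2 * 512 ^ n + (\<Sum>j<n. 8 * 512 ^ (n - 1) * check_density j)"
  proof (intro add_mono sum_mono)
    have "real (card {u. monochrome u \<and> length u = n}) \<le> real (2 * 512 ^ n)"
      using card_monochrome by (simp only: of_nat_le_iff)
    then show "real (card {u. monochrome u \<and> length u = n}) \<le> 2 * 512 ^ n" by simp
  next
    fix j assume j: "j \<in> {..<n}"
    have "card (?H j) \<le> card (?G j) * card (?T (n - 1 - j))"
      by (rule order_trans[OF card_image_le]) (auto simp: card_cartesian_product fG)
    then have "real (card (?H j)) \<le> real (card (?G j)) * real (card (?T (n - 1 - j)))"
      by (simp flip: of_nat_mult)
    also have "\<dots> \<le> (2 * (512 ^ j * check_density j)) * (4 * 512 ^ (n - 1 - j))"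
      using j by (intro mult_mono card_monochrome_closable less) (auto simp: check_density_nonneg)
    also have "\<dots> = 8 * (512 ^ j * 512 ^ (n - 1 - j)) * check_density j" by simp
    also have "512 ^ j * 512 ^ (n - 1 - j) = (512::real) ^ (n - 1)"
      using j by (simp flip: power_add)
    finally show "real (card (?H j)) \<le> 8 * 512 ^ (n - 1) * check_density j" .
  qed
  also have "\<dots> = 2 * 512 ^ n + 8 * 512 ^ (n - 1) * (\<Sum>j<n. check_density j)"
    by (simp add: sum_distrib_left)
  also have "\<dots> \<le> 4 * 512 ^ n"
  proof (cases n)
    case (Suc m)
    have "8 * 512 ^ m * (\<Sum>j<n. check_density j) \<le> 8 * 512 ^ m * (128::real)"
      by (intro mult_left_mono sum_check_density_le) auto
    then show ?thesis using Suc by simp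
  qed simp
  finally show ?case .
qed

section \<open>The subshift\<close>

lemma length_word_at [simp]: "length (word_at x m n) = n"
  by (simp add: word_at_def)

lemma word_at_nth [simp]: "i < n \<Longrightarrow> word_at x m n ! i = x (m + int i)"
  by (simp add: word_at_def)

lemma word_at_append: "word_at x m (a + b) = word_at x m a @ word_at x (m + int a) b"
  by (rule nth_equalityI) (auto simp: nth_append algebra_simps of_nat_diff)

lemma word_at_shift [simp]: "word_at (shift x) m n = word_at x (m + 1) n"
  by (rule nth_equalityI) (auto simp: shift_def algebra_simps)

definition word_shift :: "('a list \<Rightarrow> bool) \<Rightarrow> (int \<Rightarrow> 'a) set" where
  "word_shift P = {x. \<forall>m n. P (word_at x m n)}"

lemma open_word_at:
  fixes w :: "'a::discrete_topology list"
  shows "open {x. word_at x m n = w}"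
proof (cases "length w = n")
  case True
  then have "{x. word_at x m n = w} = (\<Inter>i\<in>{..<n}. (\<lambda>x. x (m + int i)) -` {w ! i})"
    by (auto simp: list_eq_iff_nth_eq)
  also have "open \<dots>"
    by (intro open_INT ballI open_vimage Topological_Spaces.open_discrete continuous_on_product_coordinates) auto
  finally show ?thesis .
next
  case False
  then have "{x. word_at x m n = w} = {}" by auto
  then show ?thesis by simp
qed

lemma closed_word_shift:
  fixes P :: "'a::discrete_topology list \<Rightarrow> bool"
  shows "closed (word_shift P)"
proof -
  have "- word_shift P = (\<Union>m. \<Union>n. \<Union>w\<in>{w. \<not> P w}. {x. word_at x m n = w})"
    by (auto simp: word_shift_def)
  also have "open \<dots>" by (intro open_UN ballI open_word_at)
  finally show ?thesis by (simp add: closed_def)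
qed

lemma shift_word_shift: "shift ` word_shift P = word_shift P"
proof
  show "shift ` word_shift P \<subseteq> word_shift P" by (auto simp: word_shift_def)
  show "word_shift P \<subseteq> shift ` word_shift P"
  proof
    fix x assume x: "x \<in> word_shift P"
    define y where "y = (\<lambda>m. x (m - 1))"
    have "shift y = x" by (auto simp: y_def shift_def)
    moreover have "word_at y m n = word_at x (m - 1) n" for m n
      by (rule nth_equalityI) (auto simp: y_def algebra_simps)
    then have "y \<in> word_shift P" using x by (auto simp: word_shift_def)
    ultimately show "x \<in> shift ` word_shift P" by blast
  qed
qed

abbreviation "alphabet \<equiv> insert 0 (letters 1 \<union> letters 2)"

abbreviation "marked_shift \<equiv> word_shift legal"

lemma subshift_marked_shift: "subshift alphabet marked_shift"
  unfolding subshift_def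
proof (intro conjI closed_word_shift shift_word_shift subsetI)
  fix x assume x: "x \<in> marked_shift"
  have "x m \<in> alphabet" for m
  proof -
    have "legal (word_at x m 1)" using x by (auto simp: word_shift_def)
    from legal_finite[OF this] show ?thesis by (simp add: word_at_def)
  qed
  then show "x \<in> full_shift alphabet" by (auto simp: full_shift_def)
qed

text \<open>
  A legal word extends to a point with markers to its left, where they impose
  no condition on its first run, and its last letter repeated to its right.
\<close>

lemma language_marked_shift: "language marked_shift = {w. legal w}"
proof (intro set_eqI iffI; unfold mem_Collect_eq)
  fix w assume "w \<in> language marked_shift"
  then obtain x m where x: "x \<in> marked_shift" "w = word_at x m (length w)" by (auto simp: language_def)
  from x(1) have "legal (word_at x m (length w))" by (auto simp: word_shift_def)
  then show "legal w" by (simp only: x(2)[symmetric])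
next
  fix w assume "legal w"
  \<comment> \<open>The empty word has no last letter to repeat.\<close>
  define v where "v = (if w = [] then [0] else w)"
  have v: "legal v" "v \<noteq> []" using \<open>legal w\<close> legal_zero by (auto simp: v_def)
  define x where "x j = (if j < 0 then 0 else if j < int (length v) then v ! nat j else last v)" for j
  have x_in: "x \<in> marked_shift"
    unfolding word_shift_def
  proof (intro CollectI allI)
    fix m n
    define a where "a = nat \<bar>m\<bar>"
    have "legal (replicate k 0 @ v @ replicate (a + n) (last v))" for k
      using legal_snoc_last[OF v, of "a + n"] by (induction k) (auto simp: legal_Cons_zero)
    moreover have "replicate a 0 @ v @ replicate (a + n) (last v) = word_at x (- int a) (a + (length v + (a + n)))"
      by (rule nth_equalityI) (auto simp: nth_append x_def nat_diff_distrib)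
    moreover have start: "- int a + int (nat (m + int a)) = m" by (auto simp: a_def)
    ultimately have "legal (word_at x (- int a) (a + (length v + (a + n))))" by metis
    also have "a + (length v + (a + n)) = nat (m + int a) + (n + nat (int a - m + int (length v)))"
      by (auto simp: a_def)
    finally have "legal (word_at x (- int a) (nat (m + int a)) @ word_at x m n @
        word_at x (m + int n) (nat (int a - m + int (length v))))"
      by (simp only: word_at_append start)
    then show "legal (word_at x m n)" by (rule legal_factor)
  qed
  have "w = word_at x 0 (length w)"
    by (rule nth_equalityI) (auto simp: x_def v_def)
  with x_in show "w \<in> language marked_shift" unfolding language_def by blast
qed

lemma full_shift_subset_marked_shift:
  assumes "t = 1 \<or> t = 2"
  shows "full_shift (letters t) \<subseteq> marked_shift"
proof
  fix x assume "x \<in> full_shift (letters t)"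
  then have "monochrome (word_at x m n)" for m n
    using assms by (auto simp: full_shift_def monochrome_def word_at_def)
  then show "x \<in> marked_shift" by (auto simp: word_shift_def legal_monochrome)
qed

lemma mistake_loglog_sublinear: "(\<lambda>n. real (mistake_loglog n) / real n) \<longlonglongrightarrow> 0"
proof (rule tendsto_sandwich)
  show "\<forall>\<^sub>F n in sequentially. 0 \<le> real (mistake_loglog n) / real n" by simp
  show "\<forall>\<^sub>F n in sequentially.
      real (mistake_loglog n) / real n \<le> (1 + 2 * log 2 (log 2 (real n))) / real n"
  proof (rule eventually_sequentiallyI)
    fix n :: nat assume n: "2 \<le> n"
    then have "1 \<le> log 2 (real n)" by (simp add: le_log_iff)
    then have "0 \<le> log 2 (log 2 (real n))" by simp
    then have "real (nat \<lfloor>log 2 (log 2 (real n))\<rfloor>) \<le> log 2 (log 2 (real n))" by linarith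
    then show "real (mistake_loglog n) / real n \<le> (1 + 2 * log 2 (log 2 (real n))) / real n"
      using n by (intro divide_right_mono) (auto simp: mistake_loglog_def)
  qed
  show "(\<lambda>n. (1 + 2 * log 2 (log 2 (real n))) / real n) \<longlonglongrightarrow> 0" by real_asymp
qed simp

lemma left_almost_specification_marked_shift: "left_almost_specification marked_shift mistake_loglog"
  unfolding left_almost_specification_def language_marked_shift
proof (intro conjI mistake_loglog_sublinear ballI)
  fix w w' assume "w \<in> Collect legal" "w' \<in> Collect legal"
  then have "legal w" "legal w'" by auto
  then obtain v where v: "length v = length w" "legal (v @ w')"
    "w \<noteq> [] \<Longrightarrow> hamming v w \<le> mistake_loglog (length w)"
    by (rule legal_left_specification) blast
  moreover from this have "legal v" using legal_factor[of "[]" v w'] by simp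
  ultimately show "\<exists>v\<in>Collect legal. length v = length w \<and>
      (w \<noteq> [] \<longrightarrow> hamming v w \<le> mistake_loglog (length w)) \<and> v @ w' \<in> Collect legal"
    by blast
qed

lemma entropy_marked_shift: "topological_entropy marked_shift = ln 512"
proof -
  have eq: "language_n marked_shift n = {w. legal w \<and> length w = n}" for n
    by (auto simp: language_n_def language_marked_shift)
  have lower: "512 ^ n \<le> real (card (language_n marked_shift n))" for n
  proof -
    have "card {u. set u \<subseteq> letters 1 \<and> length u = n} \<le> card (language_n marked_shift n)"
      unfolding eq by (rule card_mono[OF finite_legal]) (auto simp: legal_monochrome monochrome_def)
    then have "512 ^ n \<le> card (language_n marked_shift n)" by (simp add: card_lists_length_eq)
    then have "real (512 ^ n) \<le> real (card (language_n marked_shift n))" by (simp only: of_nat_le_iff)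
    then show ?thesis by simp
  qed
  have "(\<lambda>n. ln (real (card (language_n marked_shift n))) / real n) \<longlonglongrightarrow> ln 512"
  proof (rule tendsto_sandwich)
    show "\<forall>\<^sub>F n in sequentially. ln 512 \<le> ln (real (card (language_n marked_shift n))) / real n"
    proof (rule eventually_sequentiallyI)
      fix n :: nat assume n: "1 \<le> n"
      have "ln (512 ^ n) \<le> ln (real (card (language_n marked_shift n)))"
        using lower[of n] by (intro ln_mono) (auto intro: less_le_trans[of 0 "512 ^ n"])
      then show "ln 512 \<le> ln (real (card (language_n marked_shift n))) / real n"
        using n by (simp add: ln_realpow field_simps)
    qed
    show "\<forall>\<^sub>F n in sequentially. ln (real (card (language_n marked_shift n))) / real n \<le> ln 4 / real n + ln 512"
    proof (rule eventually_sequentiallyI)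
      fix n :: nat assume n: "1 \<le> n"
      have "0 < real (card (language_n marked_shift n))" using lower[of n] by (auto intro: less_le_trans[of 0 "512 ^ n"])
      then have "ln (real (card (language_n marked_shift n))) \<le> ln (4 * 512 ^ n)"
        using card_legal[of n] unfolding eq by (intro ln_mono) auto
      also have "\<dots> = ln 4 + n * ln 512" by (simp add: ln_mult ln_realpow)
      finally show "ln (real (card (language_n marked_shift n))) / real n \<le> ln 4 / real n + ln 512"
        using n by (simp add: field_simps)
    qed
    show "(\<lambda>n. ln 4 / real n + ln 512) \<longlonglongrightarrow> ln (512::real)" by real_asymp
  qed simp
  then show ?thesis unfolding topological_entropy_def by (rule limI)
qed

section \<open>Uniform Bernoulli measures on a subshift\<close>

definition uniform_product :: "nat set \<Rightarrow> (int \<Rightarrow> nat) measure" where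
  "uniform_product B = PiM UNIV (\<lambda>_. measure_pmf (pmf_of_set B))"

lemma sets_uniform_product: "sets (uniform_product B) = sets borel"
proof -
  have "sets (borel :: nat measure) = UNIV"
    by (auto intro: borel_open Topological_Spaces.open_discrete)
  then have "sets (uniform_product B) = sets (PiM UNIV (\<lambda>_::int. borel :: nat measure))"
    unfolding uniform_product_def by (intro sets_PiM_cong) auto
  then show ?thesis by (simp add: sets_PiM_equal_borel)
qed

lemma space_uniform_product [simp]: "space (uniform_product B) = UNIV"
  by (simp add: uniform_product_def space_PiM)

lemma prob_space_uniform_product: "prob_space (uniform_product B)"
  unfolding uniform_product_def by (intro prob_space_PiM prob_space_measure_pmf)

lemma shift_uniform_product: "distr (uniform_product B) (uniform_product B) shift = uniform_product B"
proof -
  have "distr (uniform_product B) (uniform_product B) (\<lambda>\<omega>. \<lambda>n\<in>UNIV. \<omega> (n + 1)) = uniform_product B"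
    unfolding uniform_product_def
    by (rule distr_PiM_reindex) (auto intro: prob_space_measure_pmf injI)
  then show ?thesis by (simp add: restrict_UNIV shift_def[abs_def])
qed

lemma measure_uniform_product_word:
  assumes "finite B" "B \<noteq> {}"
  shows "measure (uniform_product B) {x. word_at x m (length w) = w}
    = (if set w \<subseteq> B then 1 / real (card B) ^ length w else 0)"
proof -
  interpret product_prob_space "\<lambda>_::int. measure_pmf (pmf_of_set B)" UNIV
    by unfold_locales
  let ?J = "(\<lambda>i. m + int i) ` {..<length w}"
  have inj: "inj_on (\<lambda>i. m + int i) {..<length w}" by (auto intro: inj_onI)
  have "{x. word_at x m (length w) = w} =
     prod_emb UNIV (\<lambda>_. measure_pmf (pmf_of_set B)) ?J (\<Pi>\<^sub>E j\<in>?J. {w ! nat (j - m)})"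
    by (auto simp: prod_emb_def list_eq_iff_nth_eq PiE_iff space_PiM)
  then have "measure (uniform_product B) {x. word_at x m (length w) = w}
     = (\<Prod>j\<in>?J. measure (measure_pmf (pmf_of_set B)) {w ! nat (j - m)})"
    unfolding uniform_product_def by (simp only:) (rule measure_PiM_emb; auto)
  also have "\<dots> = (\<Prod>i<length w. pmf (pmf_of_set B) (w ! i))"
    by (subst prod.reindex[OF inj]) (simp add: measure_pmf_single)
  also have "\<dots> = (\<Prod>i<length w. if w ! i \<in> B then 1 / real (card B) else 0)"
    using assms by (intro prod.cong) (auto simp: indicator_def)
  also have "\<dots> = (if set w \<subseteq> B then 1 / real (card B) ^ length w else 0)"
  proof (cases "set w \<subseteq> B")
    case True
    then have "(\<Prod>i<length w. if w ! i \<in> B then 1 / real (card B) else 0) = (\<Prod>i<length w. 1 / real (card B))"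
      by (intro prod.cong) (auto dest: nth_mem)
    with True show ?thesis by (simp add: power_one_over)
  next
    case False
    then obtain i where "i < length w" "w ! i \<notin> B" by (metis in_set_conv_nth subsetI)
    then have "(\<Prod>i<length w. if w ! i \<in> B then 1 / real (card B) else 0) = 0"
      by (intro prod_zero) auto
    with False show ?thesis by simp
  qed
  finally show ?thesis .
qed

lemma AE_uniform_product:
  assumes "finite B" "B \<noteq> {}"
  shows "AE x in uniform_product B. x \<in> full_shift B"
proof -
  interpret product_prob_space "\<lambda>_::int. measure_pmf (pmf_of_set B)" UNIV
    by unfold_locales
  have "AE x in uniform_product B. x m \<in> B" for m :: int
    unfolding uniform_product_def
    using AE_component[of m "\<lambda>c. c \<in> B"] assms by (auto simp: AE_measure_pmf_iff)
  then show ?thesis by (simp add: full_shift_def AE_all_countable)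
qed

text \<open>
  The measure must live on the subshift \<open>Y\<close> itself; it has full mass there once \<open>Y\<close> contains the full
  shift over \<open>B\<close>.
\<close>

definition bernoulli_on :: "(int \<Rightarrow> nat) set \<Rightarrow> nat set \<Rightarrow> (int \<Rightarrow> nat) measure" where
  "bernoulli_on Y B = restrict_space (uniform_product B) Y"

locale bernoulli_subshift =
  fixes A B :: "nat set" and Y :: "(int \<Rightarrow> nat) set"
  assumes fin: "finite A" and B: "B \<subseteq> A" "B \<noteq> {}"
    and sub: "subshift A Y" and full: "full_shift B \<subseteq> Y"
begin

lemma finB: "finite B"
  using fin B(1) finite_subset by blast

lemma Y_sets: "Y \<in> sets (uniform_product B)"
  using sub by (simp add: sets_uniform_product subshift_def borel_closed)

lemma space_bernoulli_on [simp]: "space (bernoulli_on Y B) = Y"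
  by (simp add: bernoulli_on_def space_restrict_space)

lemma AE_Y: "AE x in uniform_product B. x \<in> Y"
  using AE_uniform_product[OF finB B(2)] full by (auto elim: eventually_mono)

lemma measure_bernoulli_on:
  assumes "S \<in> sets (uniform_product B)"
  shows "measure (bernoulli_on Y B) (S \<inter> Y) = measure (uniform_product B) S"
proof -
  interpret prob_space "uniform_product B" by (rule prob_space_uniform_product)
  have "measure (bernoulli_on Y B) (S \<inter> Y) = measure (uniform_product B) (S \<inter> Y)"
    unfolding bernoulli_on_def by (rule measure_restrict_space) (use Y_sets in auto)
  also have "\<dots> = measure (uniform_product B) S"
    using AE_Y assms Y_sets by (intro finite_measure_eq_AE) (auto elim: eventually_mono)
  finally show ?thesis .
qed

lemma invariant_bernoulli_on: "invariant_prob Y (bernoulli_on Y B)"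
  unfolding invariant_prob_def
proof (intro conjI ballI)
  interpret prob_space "uniform_product B" by (rule prob_space_uniform_product)
  show "prob_space (bernoulli_on Y B)"
    unfolding bernoulli_on_def
  proof (rule prob_space_restrict_space)
    show "Y \<in> sets (uniform_product B)" by (rule Y_sets)
    show "emeasure (uniform_product B) Y = 1"
      using AE_Y Y_sets by (simp add: emeasure_eq_1_AE)
  qed
  show "sets (bernoulli_on Y B) = sets (restrict_space borel Y)"
    unfolding bernoulli_on_def by (intro sets_restrict_space_cong sets_uniform_product)
  show "space (bernoulli_on Y B) = Y" by simp
  fix S assume "S \<in> sets (bernoulli_on Y B)"
  then have S: "S \<in> sets (uniform_product B)" "S \<subseteq> Y"
    using Y_sets by (auto simp: bernoulli_on_def sets_restrict_space_iff)
  have meas: "shift \<in> measurable (uniform_product B) (uniform_product B)"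
    unfolding uniform_product_def shift_def by (rule measurable_PiM_single') (auto simp: space_PiM)
  have "shift -` S \<in> sets (uniform_product B)"
    using measurable_sets[OF meas S(1)] by simp
  then have "measure (bernoulli_on Y B) (shift -` S \<inter> Y) = measure (uniform_product B) (shift -` S)"
    by (rule measure_bernoulli_on)
  also have "\<dots> = measure (distr (uniform_product B) (uniform_product B) shift) S"
    using measure_distr[OF meas S(1)] by simp
  also have "\<dots> = measure (uniform_product B) S" by (simp only: shift_uniform_product)
  also have "\<dots> = measure (bernoulli_on Y B) S"
    using measure_bernoulli_on[OF S(1)] S(2) by (simp add: Int_absorb2)
  finally show "measure (bernoulli_on Y B) (shift -` S \<inter> Y) = measure (bernoulli_on Y B) S" .
qed

lemma cylinder_sets: "{x. word_at x m n = w} \<in> sets (uniform_product B)"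
  unfolding sets_uniform_product by (intro borel_open open_word_at)

lemma measure_bernoulli_on_word:
  "measure (bernoulli_on Y B) ({x. word_at x m (length w) = w} \<inter> Y)
    = (if set w \<subseteq> B then 1 / real (card B) ^ length w else 0)"
  unfolding measure_bernoulli_on[OF cylinder_sets] measure_uniform_product_word[OF finB B(2)] ..

lemma entropy_bernoulli_on: "measure_entropy A (bernoulli_on Y B) = ln (card B)"
proof -
  let ?\<mu> = "bernoulli_on Y B"
  let ?f = "\<lambda>w. measure ?\<mu> (cylinder w \<inter> space ?\<mu>) * ln (measure ?\<mu> (cylinder w \<inter> space ?\<mu>))"
  have pos: "0 < card B" using finB B(2) by (simp add: card_gt_0_iff)
  have sum: "(\<Sum>w | set w \<subseteq> A \<and> length w = n. ?f w) = - (real n * ln (card B))" for n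
  proof -
    have f: "?f w = (if set w \<subseteq> B then - (real n * ln (card B) / real (card B) ^ n) else 0)"
      if "length w = n" for w
      using measure_bernoulli_on_word[of 1 w] that pos by (simp add: cylinder_def ln_div ln_realpow)
    have "(\<Sum>w | set w \<subseteq> A \<and> length w = n. ?f w) = (\<Sum>w | set w \<subseteq> B \<and> length w = n. ?f w)"
    proof (rule sum.mono_neutral_right)
      show "\<forall>w\<in>{w. set w \<subseteq> A \<and> length w = n} - {w. set w \<subseteq> B \<and> length w = n}. ?f w = 0"
      proof
        fix w assume "w \<in> {w. set w \<subseteq> A \<and> length w = n} - {w. set w \<subseteq> B \<and> length w = n}"
        then have w: "length w = n" "\<not> set w \<subseteq> B" by auto
        show "?f w = 0" unfolding f[OF w(1)] using w(2) by simp
      qed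
    qed (use fin B in \<open>auto simp: finite_lists_length_eq\<close>)
    also have "\<dots> = (\<Sum>w | set w \<subseteq> B \<and> length w = n. - (real n * ln (card B) / real (card B) ^ n))"
    proof (rule sum.cong)
      fix w assume "w \<in> {w. set w \<subseteq> B \<and> length w = n}"
      then have w: "length w = n" "set w \<subseteq> B" by auto
      show "?f w = - (real n * ln (card B) / real (card B) ^ n)" unfolding f[OF w(1)] using w(2) by simp
    qed simp
    also have "\<dots> = - (real n * ln (card B))"
      using pos by (simp add: card_lists_length_eq finB)
    finally show ?thesis .
  qed
  have "(\<lambda>n. - (\<Sum>w | set w \<subseteq> A \<and> length w = n. ?f w) / real n) \<longlonglongrightarrow> ln (card B)"
    unfolding sum by (rule tendsto_eventually, rule eventually_sequentiallyI[of 1]) auto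
  then show ?thesis unfolding measure_entropy_def by (rule limI)
qed

lemma support_bernoulli_on: "measure_support (bernoulli_on Y B) \<subseteq> full_shift B"
proof
  fix x assume x: "x \<in> measure_support (bernoulli_on Y B)"
  have "x m \<in> B" for m
  proof -
    let ?U = "{y. word_at y m (length [x m]) = [x m]}"
    have "open ?U" by (rule open_word_at)
    moreover have "x \<in> ?U" by (simp add: word_at_def)
    ultimately have "0 < measure (bernoulli_on Y B) (?U \<inter> Y)"
      using x by (simp add: measure_support_def)
    then show ?thesis unfolding measure_bernoulli_on_word by (auto split: if_splits)
  qed
  then show "x \<in> full_shift B" by (simp add: full_shift_def)
qed

end

section \<open>Two measures of maximal entropy\<close>

lemma bernoulli_subshift_marked_shift:
  assumes "t = 1 \<or> t = 2"
  shows "bernoulli_subshift alphabet (letters t) marked_shift"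
  using assms subshift_marked_shift full_shift_subset_marked_shift[OF assms] by unfold_locales auto

theorem theorem1p4:
  "\<exists>(A :: nat set) (X :: (int \<Rightarrow> nat) set).
     finite A \<and> subshift A X \<and>
     left_almost_specification X mistake_loglog \<and>
     (\<exists>\<mu> \<nu>. max_entropy_measure A X \<mu> \<and> max_entropy_measure A X \<nu> \<and> \<mu> \<noteq> \<nu> \<and>
        measure_support \<mu> \<inter> measure_support \<nu> = {})"
proof -
  interpret B1: bernoulli_subshift alphabet "letters 1" marked_shift by (rule bernoulli_subshift_marked_shift) simp
  interpret B2: bernoulli_subshift alphabet "letters 2" marked_shift by (rule bernoulli_subshift_marked_shift) simp
  let ?\<mu> = "bernoulli_on marked_shift (letters 1)" and ?\<nu> = "bernoulli_on marked_shift (letters 2)"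
  have disj: "letters 1 \<inter> letters 2 = {}" by (auto simp: letters_def)
  have "max_entropy_measure alphabet marked_shift ?\<mu>" "max_entropy_measure alphabet marked_shift ?\<nu>"
    using B1.invariant_bernoulli_on B2.invariant_bernoulli_on
      B1.entropy_bernoulli_on B2.entropy_bernoulli_on entropy_marked_shift
    by (simp_all add: max_entropy_measure_def)
  moreover have "?\<mu> \<noteq> ?\<nu>"
  proof
    obtain c where c: "c \<in> letters 1" using letters_nonempty by blast
    then have "c \<notin> letters 2" using disj by blast
    assume "?\<mu> = ?\<nu>"
    then show False
      using B1.measure_bernoulli_on_word[of 0 "[c]"] B2.measure_bernoulli_on_word[of 0 "[c]"]
        c \<open>c \<notin> letters 2\<close> by simp
  qed
  moreover have "measure_support ?\<mu> \<inter> measure_support ?\<nu> = {}"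
  proof -
    have "full_shift (letters 1) \<inter> full_shift (letters 2) = {}"
      using disj by (auto simp: full_shift_def)
    then show ?thesis using B1.support_bernoulli_on B2.support_bernoulli_on by blast
  qed
  ultimately show ?thesis
    using subshift_marked_shift left_almost_specification_marked_shift by (intro exI[of _ alphabet] exI[of _ marked_shift]) auto
qed

end
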